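(* Let $r$ be a nonnegative integer, let $u_1<u_2$ be real numbers, and let $p(t)$ and $q(t)$ be two functions defined on $[u_1,u_2]$. For nonnegative integers $n\geq k$ define $$f(n,k)=\frac{(n+r)!}{n!}\int_{u_1}^{u_2} p^k(t)\,q^{n-k}(t)\,dt .$$ Let $\{a_n\}_{n\geq 0}$ and $\{b_n\}_{n\geq 0}$ be any two sequences, with ordinary generating functions $A(x)=\sum_{n\geq0}a_nx^n$ and $B(x)=\sum_{n\geq0}b_nx^n$. Then $$\sum_{n\geq 0}\left[\sum_{k=0}^n f(n,k)\,a_k b_{n-k}\right]x^n=\frac{d^r}{dx^r}\left[x^r\int_{u_1}^{u_2}A(xp(t))\,B(xq(t))\,dt\right].$$
   Context: The identity is between power series in $x$: the integral on the right-hand side is understood as the power series in $x$ obtained by integrating term by term in $t$ (so the coefficient of $x^n$ inside the brackets is $\int_{u_1}^{u_2}\sum_{k=0}^n a_kb_{n-k}p^k(t)q^{n-k}(t)\,dt$), all integrals $\int_{u_1}^{u_2}p^k q^{n-k}\,dt$ being assumed to exist. *)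

theory Defs
  imports "HOL-Analysis.Analysis" "HOL-Computational_Algebra.Formal_Power_Series"
begin

text \<open>Values are taken in an arbitrary real normed field, which covers both real-valued and
  complex-valued functions and sequences. Integrals are Henstock--Kurzweil integrals, which
  agree with the Riemann and Lebesgue integrals wherever those exist.\<close>

definition integral_coeff ::
    "nat \<Rightarrow> real \<Rightarrow> real \<Rightarrow> (real \<Rightarrow> 'a::real_normed_field) \<Rightarrow> (real \<Rightarrow> 'a) \<Rightarrow> nat \<Rightarrow> nat \<Rightarrow> 'a" where
  "integral_coeff r u1 u2 p q n k =
     fact (n + r) / fact n * integral {u1..u2} (\<lambda>t. p t ^ k * q t ^ (n - k))"

text \<open>Integral over \<open>t\<close> of a family of power series in \<open>x\<close>, taken coefficient by coefficient.\<close>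

definition fps_termwise_integral :: "real \<Rightarrow> real \<Rightarrow> (real \<Rightarrow> 'a::real_normed_field fps) \<Rightarrow> 'a fps" where
  "fps_termwise_integral u1 u2 F = Abs_fps (\<lambda>n. integral {u1..u2} (\<lambda>t. fps_nth (F t) n))"

end

theory Submission
  imports Defs
begin

text \<open>Compare coefficients of \<open>x^n\<close>. Multiplying by \<open>x^r\<close> shifts
  indices up by \<open>r\<close>, and \<open>r\<close> derivatives shift them back while producing
  the factor \<open>(n+r)!/n!\<close> (\<open>fps_nth_higher_deriv\<close>), which is the one in
  \<open>integral_coeff\<close>. What remains is that the integral commutes with the finite Cauchy
  product sum.\<close>

lemma fps_nth_higher_deriv:
  fixes f :: "'a::field_char_0 fps"
  shows "fps_nth ((fps_deriv ^^ r) f) n = fact (n + r) / fact n * fps_nth f (n + r)"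
proof (induction r arbitrary: n)
  case 0
  then show ?case by simp
next
  case (Suc r)
  have "fact (Suc n) = (of_nat (Suc n) * fact n :: 'a)" by (rule fact_Suc)
  moreover have "(of_nat (Suc n) :: 'a) \<noteq> 0" by (rule of_nat_neq_0)
  \<comment> \<open>The outermost derivative contributes \<open>n + 1\<close> and moves to index
    \<open>Suc n\<close>. Keeping \<open>of_nat (Suc n)\<close> folded lets it cancel against the
    same factor of \<open>fact (Suc n)\<close>.\<close>
  ultimately show ?case
    using Suc.IH[of "Suc n"] by (simp del: of_nat_Suc fact_Suc)
qed

theorem theorem1:
  fixes r :: nat and u1 u2 :: real
    and p q :: "real \<Rightarrow> 'a::real_normed_field"
    and a b :: "nat \<Rightarrow> 'a"
  assumes "u1 < u2"
    and "\<And>n k. k \<le> n \<Longrightarrow> (\<lambda>t. p t ^ k * q t ^ (n - k)) integrable_on {u1..u2}"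
  shows "Abs_fps (\<lambda>n. \<Sum>k=0..n. integral_coeff r u1 u2 p q n k * a k * b (n - k)) =
    (fps_deriv ^^ r) (fps_X ^ r * fps_termwise_integral u1 u2
       (\<lambda>t. fps_compose (Abs_fps a) (fps_const (p t) * fps_X) *
            fps_compose (Abs_fps b) (fps_const (q t) * fps_X)))"
    (is "?L = (fps_deriv ^^ r) (fps_X ^ r * fps_termwise_integral u1 u2 ?F)")
proof (rule fps_ext)
  fix n
  let ?I = "\<lambda>k. integral {u1..u2} (\<lambda>t. p t ^ k * q t ^ (n - k))"
  \<comment> \<open>Substituting \<open>c * x\<close> for \<open>x\<close> scales the
    \<open>k\<close>-th coefficient by \<open>c ^ k\<close>.\<close>
  have F: "fps_nth (?F t) n = (\<Sum>k=0..n. (p t ^ k * q t ^ (n - k)) * (a k * b (n - k)))" for t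
    unfolding fps_compose_linear fps_mult_nth by (simp add: mult_ac)
  \<comment> \<open>\<open>has_integral\<close> carries existence along with the value, so linearity
    applies termwise; \<open>k \<le> n\<close> in the hypothesis comes from the summation
    range.\<close>
  have "((\<lambda>t. fps_nth (?F t) n) has_integral (\<Sum>k=0..n. ?I k * (a k * b (n - k)))) {u1..u2}"
    unfolding F
    by (intro has_integral_sum has_integral_mult_left integrable_integral assms(2)) auto
  then have "fps_nth (fps_termwise_integral u1 u2 ?F) n = (\<Sum>k=0..n. ?I k * (a k * b (n - k)))"
    unfolding fps_termwise_integral_def by (simp add: integral_unique)
  then show "fps_nth ?L n =
      fps_nth ((fps_deriv ^^ r) (fps_X ^ r * fps_termwise_integral u1 u2 ?F)) n"
    by (simp add: fps_nth_higher_deriv fps_X_power_mult_nth integral_coeff_def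
        sum_distrib_left mult_ac)
qed

end
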